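(* Let $f\colon\mathbb{R}^d\to\mathbb{R}\cup\{+\infty\}$ be closed and $\mu$-strongly convex ($\mu>0$). Fix $\delta>0$, $p\in(0,1)$, $T\in\mathbb{N}$ and penalties $0\le\lambda_0\le\dots\le\lambda_T$ (with $\lambda_{-1}:=0$). Then with probability at least $1-(T+2)p$, the point $x_{T+1}=\mathtt{proxBoost}(\delta,p,T)$ (defined in the context) satisfies $$f(x_{T+1})-\min f\le \delta\left(1+\sum_{i=0}^{T}\frac{\lambda_i}{\mu+\lambda_{i-1}}\right).$$
   Context: $\mu$-strongly convex means $f-\frac{\mu}{2}\|\cdot\|^2$ is convex. $B_r(x)$ is the closed Euclidean ball. The procedure $\mathtt{proxBoost}(\delta,p,T)$ generates random points $x_0,\dots,x_{T+1}\in\mathbb{R}^d$ as follows. Set $\lambda_{-1}=0$ and $\varepsilon_j=\sqrt{\frac{2\delta}{\mu+\lambda_j}}$ for $j=-1,0,\dots,T-1$. Let $\bar x_0=\operatorname{argmin} f$, and for $i=0,\dots,T$ let $f^i(x)=f(x)+\frac{\lambda_i}{2}\|x-x_i\|^2$ and $\bar x_{i+1}=\operatorname{argmin} f^i$ (these depend on the random point $x_i$). For $j=0,\dots,T$ let $E_j$ be the event $\{x_i\in B_{\varepsilon_{i-1}}(\bar x_i)\text{ for all } i=0,\dots,j\}$. 1. $x_0$ is any random point with $\mathbb{P}[\|x_0-\bar x_0\|\le\varepsilon_{-1}]\ge 1-p$. 2. For $j=0,\dots,T-1$, $x_{j+1}$ is any random point with $\mathbb{P}[\|x_{j+1}-\bar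 x_{j+1}\|\le\varepsilon_j\mid E_j]\ge 1-p$. 3. $x_{T+1}$ is any random point with $\mathbb{P}[f^T(x_{T+1})-\min f^T\le\delta\mid E_T]\ge 1-p$. The output is $x_{T+1}$. The theorem is asserted for any points generated in accordance with these requirements. *)

theory Defs
  imports "HOL-Probability.Probability"
begin

text \<open>Functions into the reals extended by plus infinity are modelled as \<open>ereal\<close>-valued functions
  that never take the value minus infinity. For an optimization problem to have a minimizer the
  function must be finite somewhere, so properness is kept together with that requirement.\<close>

definition proper_fun :: "('a \<Rightarrow> ereal) \<Rightarrow> bool" where
  "proper_fun f \<longleftrightarrow> (\<forall>x. f x \<noteq> -\<infinity>) \<and> (\<exists>x. f x \<noteq> \<infinity>)"

text \<open>The library's \<open>epigraph\<close> is restricted to real-valued functions.\<close>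

definition ext_epigraph :: "('a \<Rightarrow> ereal) \<Rightarrow> ('a \<times> real) set" where
  "ext_epigraph f = {(x, t). f x \<le> ereal t}"

definition closed_fun :: "('a::topological_space \<Rightarrow> ereal) \<Rightarrow> bool" where
  "closed_fun f \<longleftrightarrow> closed (ext_epigraph f)"

definition convex_fun :: "('a::real_vector \<Rightarrow> ereal) \<Rightarrow> bool" where
  "convex_fun f \<longleftrightarrow> convex (ext_epigraph f)"

definition strongly_convex_fun :: "real \<Rightarrow> ('a::real_normed_vector \<Rightarrow> ereal) \<Rightarrow> bool" where
  "strongly_convex_fun \<mu> f \<longleftrightarrow> convex_fun (\<lambda>x. f x - ereal (\<mu> / 2 * (norm x)\<^sup>2))"

text \<open>For a proper closed strongly convex function the minimizer exists and is unique, so the choice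
  made by \<open>arg_min\<close> is the minimizer, and \<open>min_value f\<close> is the attained minimum.\<close>

definition argmin :: "('a \<Rightarrow> ereal) \<Rightarrow> 'a" where
  "argmin f = (ARG_MIN f x. True)"

definition min_value :: "('a \<Rightarrow> ereal) \<Rightarrow> ereal" where
  "min_value f = f (argmin f)"

definition prox_obj :: "('a::real_normed_vector \<Rightarrow> ereal) \<Rightarrow> real \<Rightarrow> 'a \<Rightarrow> 'a \<Rightarrow> ereal" where
  "prox_obj f l c = (\<lambda>x. f x + ereal (l / 2 * (norm (x - c))\<^sup>2))"

text \<open>Indices that start at \<open>-1\<close> in the usual presentation are shifted by one:
  \<open>prev_penalty lam i\<close> is \<open>\<lambda>\<^sub>i\<^sub>-\<^sub>1\<close> (with \<open>\<lambda>\<^sub>-\<^sub>1 = 0\<close>) and \<open>prev_radius \<delta> \<mu> lam i\<close> is \<open>\<epsilon>\<^sub>i\<^sub>-\<^sub>1\<close>.\<close>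

definition prev_penalty :: "(nat \<Rightarrow> real) \<Rightarrow> nat \<Rightarrow> real" where
  "prev_penalty lam i = (case i of 0 \<Rightarrow> 0 | Suc k \<Rightarrow> lam k)"

definition prev_radius :: "real \<Rightarrow> real \<Rightarrow> (nat \<Rightarrow> real) \<Rightarrow> nat \<Rightarrow> real" where
  "prev_radius \<delta> \<mu> lam i = sqrt (2 * \<delta> / (\<mu> + prev_penalty lam i))"

text \<open>\<open>prox_center f lam x i\<close> is the exact minimizer \<open>\<bar>x\<^sub>i\<close> belonging to a realization
  \<open>x 0, x 1, \<dots>\<close> of the random points.\<close>

definition prox_center ::
    "('a::real_normed_vector \<Rightarrow> ereal) \<Rightarrow> (nat \<Rightarrow> real) \<Rightarrow> (nat \<Rightarrow> 'a) \<Rightarrow> nat \<Rightarrow> 'a" where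
  "prox_center f lam x i =
     (case i of 0 \<Rightarrow> argmin f | Suc k \<Rightarrow> argmin (prox_obj f (lam k) (x k)))"

definition prox_event ::
    "('a::real_normed_vector \<Rightarrow> ereal) \<Rightarrow> real \<Rightarrow> real \<Rightarrow> (nat \<Rightarrow> real) \<Rightarrow> (nat \<Rightarrow> 'a) \<Rightarrow> nat \<Rightarrow> bool" where
  "prox_event f \<mu> \<delta> lam x j \<longleftrightarrow>
     (\<forall>i\<le>j. x i \<in> cball (prox_center f lam x i) (prev_radius \<delta> \<mu> lam i))"

text \<open>\<open>X i \<omega>\<close> is the \<open>i\<close>-th random point. A conditional probability given a null event is \<open>0\<close> in
  the library; this never matters below, because for \<open>p < 1\<close> the earlier requirements force every
  conditioning event to have positive probability.\<close>

definition prox_boost ::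
    "'w measure \<Rightarrow> ('a::euclidean_space \<Rightarrow> ereal) \<Rightarrow> real \<Rightarrow> (nat \<Rightarrow> real) \<Rightarrow>
     real \<Rightarrow> real \<Rightarrow> nat \<Rightarrow> (nat \<Rightarrow> 'w \<Rightarrow> 'a) \<Rightarrow> bool" where
  "prox_boost M f \<mu> lam \<delta> p T X \<longleftrightarrow>
     (\<forall>i\<le>T + 1. X i \<in> borel_measurable M) \<and>
     \<P>(\<omega> in M. norm (X 0 \<omega> - prox_center f lam (\<lambda>i. X i \<omega>) 0) \<le> prev_radius \<delta> \<mu> lam 0) \<ge> 1 - p \<and>
     (\<forall>j<T. \<P>(\<omega> in M.
        norm (X (j + 1) \<omega> - prox_center f lam (\<lambda>i. X i \<omega>) (j + 1)) \<le> prev_radius \<delta> \<mu> lam (j + 1)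
        \<bar> prox_event f \<mu> \<delta> lam (\<lambda>i. X i \<omega>) j) \<ge> 1 - p) \<and>
     \<P>(\<omega> in M.
        prox_obj f (lam T) (X T \<omega>) (X (T + 1) \<omega>) - min_value (prox_obj f (lam T) (X T \<omega>)) \<le> ereal \<delta>
        \<bar> prox_event f \<mu> \<delta> lam (\<lambda>i. X i \<omega>) T) \<ge> 1 - p"

end

theory Submission
  imports Defs
begin

text \<open>On the event that every \<open>x\<^sub>i\<close> is within \<open>\<epsilon>\<^sub>i\<^sub>-\<^sub>1\<close> of \<open>\<bar>x\<^sub>i\<close>, testing \<open>f\<^sup>i\<close> at the previous exact
  minimizer gives \<open>min f\<^sup>i \<le> f \<bar>x\<^sub>i + \<lambda>\<^sub>i/2 \<epsilon>\<^sub>i\<^sub>-\<^sub>1\<^sup>2 \<le> min f\<^sup>i\<^sup>-\<^sup>1 + \<delta> \<lambda>\<^sub>i / (\<mu> + \<lambda>\<^sub>i\<^sub>-\<^sub>1)\<close>, which telescopes.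
  Strong convexity enters only through the existence of these minimizers. The conditional
  requirements multiply to a probability of at least \<open>(1 - p)\<^sup>T\<^sup>+\<^sup>2\<close>, and Bernoulli's inequality
  finishes the proof. Measurability of the conditioning events comes for free: a non-measurable set
  has measure \<open>0\<close> in the library, which the requirements exclude since \<open>p < 1\<close>.\<close>

section \<open>Attained minima and closed sublevel sets\<close>

text \<open>Without a minimizer, the open sets \<open>{x. g y < g x}\<close> with y in K cover K. In
  a finite subcover, the y with the smallest value lies in none of the sets.\<close>

lemma attains_min_on_compact:
  fixes g :: "'a::topological_space \<Rightarrow> ereal"
  assumes sublevel: "\<And>t. closed {x. g x \<le> ereal t}"
    and g: "\<And>x. g x \<noteq> -\<infinity>"
    and K: "compact K" "K \<noteq> {}"
  shows "\<exists>x\<in>K. \<forall>y\<in>K. g x \<le> g y"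
proof (rule ccontr)
  assume "\<not> ?thesis"
  then have cover: "\<forall>x\<in>K. \<exists>y\<in>K. g y < g x" by (meson not_le)
  have opn: "open {x. g y < g x}" for y
  proof (cases "g y")
    case (real t)
    have "{x. g y < g x} = - {x. g x \<le> ereal t}" using real by auto
    then show ?thesis using sublevel[of t] by (simp add: open_closed)
  qed (use g in auto)
  obtain Y where Y: "Y \<subseteq> K" "finite Y" "K \<subseteq> (\<Union>y\<in>Y. {x. g y < g x})"
  proof (rule compactE_image[OF K(1), of K "\<lambda>y. {x. g y < g x}"])
    show "K \<subseteq> (\<Union>y\<in>K. {x. g y < g x})" using cover by auto
  qed (use opn in auto)
  have "Y \<noteq> {}" using Y(3) K(2) by auto
  then obtain z where z: "z \<in> Y" "g z = Min (g ` Y)"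
    using Y(2) Min_in[of "g ` Y"] by fastforce
  then have "z \<in> (\<Union>y\<in>Y. {x. g y < g x})" using Y(1,3) by blast
  then obtain y where "y \<in> Y" "g y < g z" by auto
  then show False using z(2) Y(2) by (simp add: leD)
qed

lemma closed_fun_sublevel:
  assumes "closed_fun f"
  shows "closed {x. f x \<le> ereal t}"
proof -
  have "closed ((\<lambda>x. (x, t)) -` ext_epigraph f)"
    using assms unfolding closed_fun_def
    by (intro closed_vimage) (auto intro!: continuous_intros)
  then show ?thesis by (simp add: ext_epigraph_def vimage_def)
qed

lemma prox_obj_le_iff:
  "prox_obj f l c x \<le> ereal t \<longleftrightarrow> f x \<le> ereal (t - l / 2 * (norm (x - c))\<^sup>2)"
  unfolding prox_obj_def by (cases "f x") auto

text \<open>The penalty is moved into the height coordinate, so the sublevel set is the preimage of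
  the epigraph of f under a continuous map.\<close>

lemma closed_prox_obj_sublevel:
  assumes "closed_fun f"
  shows "closed {x. prox_obj f l c x \<le> ereal t}"
proof -
  have "closed ((\<lambda>x. (x, t - l / 2 * (norm (x - c))\<^sup>2)) -` ext_epigraph f)"
    using assms unfolding closed_fun_def
    by (intro closed_vimage) (auto intro!: continuous_intros)
  then show ?thesis by (simp add: ext_epigraph_def vimage_def prox_obj_le_iff)
qed

lemma le_prox_obj: "0 \<le> l \<Longrightarrow> f x \<le> prox_obj f l c x"
  unfolding prox_obj_def by (cases "f x") auto

section \<open>Strong convexity and bounded sublevel sets\<close>

text \<open>The real bounds a and b give two points of the epigraph of
  \<open>f - \<mu>/2 * norm^2\<close>, so the remaining arithmetic is in the reals.\<close>

lemma strongly_convex_funD: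
  fixes x y :: "'a::real_inner"
  assumes "strongly_convex_fun \<mu> f" "f x \<le> ereal a" "f y \<le> ereal b" "0 \<le> s" "s \<le> 1"
  shows "f (x + s *\<^sub>R (y - x))
    \<le> ereal ((1 - s) * a + s * b - \<mu> / 2 * s * (1 - s) * (norm (y - x))\<^sup>2)"
proof -
  let ?h = "\<lambda>x. f x - ereal (\<mu> / 2 * (norm x)\<^sup>2)"
  have epi: "(z, u) \<in> ext_epigraph ?h \<longleftrightarrow> f z \<le> ereal (u + \<mu> / 2 * (norm z)\<^sup>2)" for z u
    unfolding ext_epigraph_def by (cases "f z") auto
  \<comment> \<open>The last term of this identity is the source of the quadratic gain.\<close>
  have norm_combination: "(norm (x + s *\<^sub>R (y - x)))\<^sup>2
      = (1 - s) * (norm x)\<^sup>2 + s * (norm y)\<^sup>2 - s * (1 - s) * (norm (y - x))\<^sup>2"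
    unfolding power2_norm_eq_inner
    by (simp add: inner_add_left inner_add_right inner_diff_left inner_diff_right inner_commute
        algebra_simps power2_eq_square)
  have "(x, a - \<mu> / 2 * (norm x)\<^sup>2) \<in> ext_epigraph ?h"
    "(y, b - \<mu> / 2 * (norm y)\<^sup>2) \<in> ext_epigraph ?h"
    using assms(2,3) by (simp_all only: epi) auto
  moreover have "convex (ext_epigraph ?h)"
    using assms(1) unfolding strongly_convex_fun_def convex_fun_def .
  ultimately have "(1 - s) *\<^sub>R (x, a - \<mu> / 2 * (norm x)\<^sup>2) + s *\<^sub>R (y, b - \<mu> / 2 * (norm y)\<^sup>2)
      \<in> ext_epigraph ?h"
    using assms(4,5) by (intro convexD) auto
  moreover have "(1 - s) *\<^sub>R x + s *\<^sub>R y = x + s *\<^sub>R (y - x)"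
    by (simp add: algebra_simps)
  ultimately have "f (x + s *\<^sub>R (y - x)) \<le> ereal ((1 - s) * (a - \<mu> / 2 * (norm x)\<^sup>2)
      + s * (b - \<mu> / 2 * (norm y)\<^sup>2) + \<mu> / 2 * (norm (x + s *\<^sub>R (y - x)))\<^sup>2)"
    using epi[of "x + s *\<^sub>R (y - x)"] by (simp only: scaleR_Pair add_Pair real_scaleR_def)
  moreover have "(1 - s) * (a - \<mu> / 2 * (norm x)\<^sup>2) + s * (b - \<mu> / 2 * (norm y)\<^sup>2)
        + \<mu> / 2 * (norm (x + s *\<^sub>R (y - x)))\<^sup>2
      = (1 - s) * a + s * b - \<mu> / 2 * s * (1 - s) * (norm (y - x))\<^sup>2"
    unfolding norm_combination by (simp add: field_simps)
  ultimately show ?thesis by simp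
qed

text \<open>Comparing with the minimum over a unit ball around a point of the domain shows quadratic
  growth without any affine minorant.\<close>

lemma strongly_convex_fun_bounded_sublevel:
  fixes f :: "'a::euclidean_space \<Rightarrow> ereal"
  assumes f: "proper_fun f" "closed_fun f" "strongly_convex_fun \<mu> f" and \<mu>: "0 < \<mu>"
  shows "bounded {x. f x \<le> ereal t}"
proof -
  have ninf: "f x \<noteq> -\<infinity>" for x using f(1) by (auto simp: proper_fun_def)
  obtain z a where z: "f z = ereal a"
    using f(1) unfolding proper_fun_def by (metis ereal_cases)
  obtain w where w: "w \<in> cball z 1" "\<forall>y\<in>cball z 1. f w \<le> f y"
    using attains_min_on_compact[OF closed_fun_sublevel[OF f(2)] ninf, of "cball z 1"] by auto
  have "f w \<le> ereal a" using w(2) z by (metis centre_in_cball zero_le_one)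
  then obtain m where m: "f w = ereal m" "m \<le> a"
    using ninf[of w] by (cases "f w") auto
  \<comment> \<open>R is the largest r satisfying
    \<open>\<mu> / 2 * (r - 1) \<le> \<bar>t - a\<bar> + (a - m)\<close>, the inequality derived
    below for the distance r from z to x.\<close>
  define R where "R = 1 + 2 * (\<bar>t - a\<bar> + (a - m)) / \<mu>"
  have "x \<in> cball z R" if x: "f x \<le> ereal t" for x
  proof (cases "dist z x \<le> 1")
    case True
    moreover have "0 \<le> 2 * (\<bar>t - a\<bar> + (a - m)) / \<mu>" using m(2) \<mu> by (intro divide_nonneg_pos) auto
    ultimately show ?thesis by (simp add: R_def)
  next
    case False
    define r where "r = norm (x - z)"
    have r: "1 < r" using False by (simp add: r_def dist_norm norm_minus_commute)
    \<comment> \<open>The segment from z to x leaves the unit ball at \<open>?y\<close>: there f is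
      at least m, while strong convexity bounds it from above.\<close>
    let ?y = "z + (1 / r) *\<^sub>R (x - z)"
    have "?y \<in> cball z 1" using r by (simp add: dist_norm r_def)
    then have "ereal m \<le> f ?y" using w(2) m(1) by metis
    also have "\<dots> \<le> ereal ((1 - 1 / r) * a + 1 / r * t - \<mu> / 2 * (1 / r) * (1 - 1 / r) * r\<^sup>2)"
      unfolding r_def using x z r by (intro strongly_convex_funD[OF f(3)]) (simp_all add: r_def divide_le_eq)
    finally have "r * m \<le> r * ((1 - 1 / r) * a + 1 / r * t - \<mu> / 2 * (1 / r) * (1 - 1 / r) * r\<^sup>2)"
      using r by simp
    also have "\<dots> = (r - 1) * a + t - \<mu> / 2 * (r - 1) * r"
      using r by (simp add: field_simps power2_eq_square)
    finally have "\<mu> / 2 * (r - 1) * r \<le> (t - a) + (a - m) * r"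
      by (simp add: algebra_simps)
    \<comment> \<open>Since r > 1, the constant term is absorbed into a multiple of r, and the
      factor r can be cancelled.\<close>
    also have "\<dots> \<le> \<bar>t - a\<bar> * r + (a - m) * r"
      using r mult_left_mono[of 1 r "\<bar>t - a\<bar>"] by auto
    finally have "(\<mu> / 2 * (r - 1)) * r \<le> (\<bar>t - a\<bar> + (a - m)) * r"
      by (simp add: algebra_simps)
    then have "\<mu> / 2 * (r - 1) \<le> \<bar>t - a\<bar> + (a - m)" using r by simp
    then have "r \<le> R" using \<mu> by (simp add: R_def field_simps)
    then show ?thesis by (simp add: r_def dist_norm norm_minus_commute)
  qed
  then show ?thesis by (intro bounded_subset[OF bounded_cball[of z R]]) auto
qed

section \<open>Existence of the exact minimizers\<close>

text \<open>\<open>argmin\<close> is a Hilbert choice; exhibiting one minimizer x ensures that the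
  chosen point is a minimizer too.\<close>

lemma min_value_le:
  assumes "\<And>y. g x \<le> g y"
  shows "min_value g \<le> g y"
proof -
  have "is_arg_min g (\<lambda>_. True) x" using assms by (simp add: is_arg_min_linorder)
  then have "is_arg_min g (\<lambda>_. True) (argmin g)"
    unfolding argmin_def arg_min_def by (rule someI)
  then show ?thesis by (simp add: is_arg_min_linorder min_value_def)
qed

text \<open>The sublevel set at the height of a domain point is compact: it is closed, and it lies
  in a bounded sublevel set of f because the penalty is nonnegative. A minimizer over it is global,
  since values outside are larger.\<close>

lemma min_value_prox_obj_le:
  fixes f :: "'a::euclidean_space \<Rightarrow> ereal"
  assumes f: "proper_fun f" "closed_fun f" "strongly_convex_fun \<mu> f" and \<mu>: "0 < \<mu>"
    and l: "0 \<le> l"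
  shows "min_value (prox_obj f l c) \<le> prox_obj f l c y"
proof -
  let ?g = "prox_obj f l c"
  have ninf: "?g x \<noteq> -\<infinity>" for x
    using f(1) by (auto simp: proper_fun_def prox_obj_def)
  obtain z a where "f z = ereal a"
    using f(1) unfolding proper_fun_def by (metis ereal_cases)
  then obtain b where z: "?g z = ereal b" by (simp add: prox_obj_def)
  let ?K = "{x. ?g x \<le> ereal b}"
  have "?K \<subseteq> {x. f x \<le> ereal b}" by (auto intro: order_trans[OF le_prox_obj[OF l]])
  then have "bounded ?K"
    by (rule bounded_subset[OF strongly_convex_fun_bounded_sublevel[OF f \<mu>]])
  then have "compact ?K"
    using closed_prox_obj_sublevel[OF f(2)] by (simp add: compact_eq_bounded_closed)
  moreover have "z \<in> ?K" using z by simp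
  then have "?K \<noteq> {}" by blast
  ultimately obtain x where x: "x \<in> ?K" "\<forall>y\<in>?K. ?g x \<le> ?g y"
    using attains_min_on_compact[OF closed_prox_obj_sublevel[OF f(2)] ninf, of ?K] by auto
  have "?g x \<le> ?g y" for y
    using x by (cases "y \<in> ?K") auto
  then show ?thesis by (rule min_value_le)
qed

text \<open>Makes f itself the zero-penalty case of the preceding result.\<close>

lemma prox_obj_0 [simp]: "prox_obj f 0 c = f"
  by (simp add: prox_obj_def flip: zero_ereal_def)

lemma min_value_finite:
  fixes f :: "'a::euclidean_space \<Rightarrow> ereal"
  assumes f: "proper_fun f" "closed_fun f" "strongly_convex_fun \<mu> f" and \<mu>: "0 < \<mu>"
  obtains m where "min_value f = ereal m"
proof -
  obtain z where "f z \<noteq> \<infinity>" using f(1) unfolding proper_fun_def by auto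
  moreover have "min_value f \<le> f z"
    using min_value_prox_obj_le[OF f \<mu>, of 0 0 z] by simp
  moreover have "min_value f \<noteq> -\<infinity>"
    using f(1) by (simp add: proper_fun_def min_value_def)
  ultimately show ?thesis using that by (cases "min_value f") auto
qed

section \<open>The telescoping estimate\<close>

lemma min_value_prox_obj_bound:
  fixes f :: "'a::euclidean_space \<Rightarrow> ereal"
  assumes f: "proper_fun f" "closed_fun f" "strongly_convex_fun \<mu> f" and \<mu>: "0 < \<mu>"
    and \<delta>: "0 \<le> \<delta>" and lam: "\<And>i. i \<le> k \<Longrightarrow> 0 \<le> lam i"
    and m: "min_value f = ereal m"
    and ev: "prox_event f \<mu> \<delta> lam x k"
  shows "min_value (prox_obj f (lam k) (x k))
    \<le> ereal (m + \<delta> * (\<Sum>i=0..k. lam i / (\<mu> + prev_penalty lam i)))"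
  using lam ev
proof (induction k)
  \<comment> \<open>One link of the chain: y is the previous exact minimizer, v bounds f there, and
    q stands for \<open>\<mu> + prev_penalty lam i\<close>, so the square root is the previous
    radius. The added cost is
    \<open>l / 2 * (2 * \<delta> / q) = \<delta> * (l / q)\<close>.\<close>
  have step: "min_value (prox_obj f l c) \<le> ereal (v + \<delta> * (l / q))"
    if v: "f y \<le> ereal v" and y: "c \<in> cball y (sqrt (2 * \<delta> / q))" and q: "0 < q" and l: "0 \<le> l"
    for y c v q l
  proof -
    have "norm (y - c) \<le> sqrt (2 * \<delta> / q)" using y by (simp add: dist_norm)
    then have "(norm (y - c))\<^sup>2 \<le> (sqrt (2 * \<delta> / q))\<^sup>2" by (intro power_mono) auto
    also have "\<dots> = 2 * \<delta> / q" using \<delta> q by simp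
    finally have "l / 2 * (norm (y - c))\<^sup>2 \<le> l / 2 * (2 * \<delta> / q)"
      using l by (intro mult_left_mono) auto
    then have "v \<le> (v + \<delta> * (l / q)) - l / 2 * (norm (y - c))\<^sup>2" by (simp add: algebra_simps)
    then have "prox_obj f l c y \<le> ereal (v + \<delta> * (l / q))"
      unfolding prox_obj_le_iff using v order_trans by fastforce
    then show ?thesis by (rule order_trans[OF min_value_prox_obj_le[OF f \<mu> l]])
  qed
  {
    case 0
    have "x 0 \<in> cball (argmin f) (sqrt (2 * \<delta> / \<mu>))"
      using 0(2) by (simp add: prox_event_def prox_center_def prev_radius_def prev_penalty_def)
    moreover have "f (argmin f) \<le> ereal m" using m by (simp add: min_value_def)
    ultimately show ?case using step[of "argmin f" m "x 0" \<mu> "lam 0"] \<mu> 0(1)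
      by (simp add: prev_penalty_def)
  next
    case (Suc k)
    let ?y = "argmin (prox_obj f (lam k) (x k))"
    let ?v = "m + \<delta> * (\<Sum>i=0..k. lam i / (\<mu> + prev_penalty lam i))"
    have "x (Suc k) \<in> cball ?y (sqrt (2 * \<delta> / (\<mu> + lam k)))"
      using Suc.prems(2)
      by (auto simp: prox_event_def prox_center_def prev_radius_def prev_penalty_def
          dest!: spec[of _ "Suc k"])
    moreover have "f ?y \<le> ereal ?v"
    proof -
      \<comment> \<open>The old penalty is dropped before the new one is added.\<close>
      have "f ?y \<le> min_value (prox_obj f (lam k) (x k))"
        unfolding min_value_def using Suc.prems(1)[of k] by (intro le_prox_obj) simp
      also have "\<dots> \<le> ereal ?v"
        using Suc.prems by (intro Suc.IH) (auto simp: prox_event_def)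
      finally show ?thesis .
    qed
    moreover have "0 < \<mu> + lam k" using \<mu> Suc.prems(1)[of k] by simp
    ultimately show ?case
      using step[of ?y ?v "x (Suc k)" "\<mu> + lam k" "lam (Suc k)"] Suc.prems(1)
      by (simp add: prev_penalty_def algebra_simps)
  }
qed

section \<open>Probability of the good event\<close>

text \<open>The bound \<open>0 < r\<close> makes the denominator of the conditional probability
  positive, so it can be multiplied out.\<close>

lemma (in prob_space) prob_conj_ge_if_cond_prob_ge:
  assumes "q \<le> \<P>(\<omega> in M. P \<omega> \<bar> Q \<omega>)" and "r \<le> \<P>(\<omega> in M. Q \<omega>)" and "0 \<le> q" and "0 < r"
  shows "q * r \<le> \<P>(\<omega> in M. P \<omega> \<and> Q \<omega>)"
proof -
  have "q * r \<le> q * \<P>(\<omega> in M. Q \<omega>)" using assms by (intro mult_left_mono)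
  also have "\<dots> \<le> \<P>(\<omega> in M. P \<omega> \<and> Q \<omega>)"
    using assms unfolding cond_prob_def by (simp add: pos_le_divide_eq)
  finally show ?thesis .
qed

theorem theorem3p2:
  fixes f :: "real ^ 'n \<Rightarrow> ereal"
    and \<mu> \<delta> p :: real
    and T :: nat
    and lam :: "nat \<Rightarrow> real"
    and M :: "'w measure"
    and X :: "nat \<Rightarrow> 'w \<Rightarrow> real ^ 'n"
  assumes "proper_fun f"
    and "closed_fun f"
    and "\<mu> > 0"
    and "strongly_convex_fun \<mu> f"
    and "\<delta> > 0"
    and "0 < p" and "p < 1"
    and "0 \<le> lam 0"
    and "\<And>i. i < T \<Longrightarrow> lam i \<le> lam (i + 1)"
    and "prob_space M"
    and "prox_boost M f \<mu> lam \<delta> p T X"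
  shows "\<P>(\<omega> in M. f (X (T + 1) \<omega>) - min_value f
            \<le> ereal (\<delta> * (1 + (\<Sum>i=0..T. lam i / (\<mu> + prev_penalty lam i)))))
         \<ge> 1 - (real T + 2) * p"
proof -
  interpret prob_space M by fact
  note f = assms(1,2,4,3)
  obtain m where m: "min_value f = ereal m" using min_value_finite[OF f] .
  define S where "S = (\<Sum>i=0..T. lam i / (\<mu> + prev_penalty lam i))"
  let ?E = "\<lambda>j \<omega>. prox_event f \<mu> \<delta> lam (\<lambda>i. X i \<omega>) j"
  let ?G = "\<lambda>\<omega>. prox_obj f (lam T) (X T \<omega>) (X (T + 1) \<omega>)
      - min_value (prox_obj f (lam T) (X T \<omega>)) \<le> ereal \<delta>"
  let ?A = "\<lambda>\<omega>. f (X (T + 1) \<omega>) - min_value f \<le> ereal (\<delta> * (1 + S))"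
  have lam: "0 \<le> lam i" if "i \<le> T" for i
    using that
  proof (induction i)
    case (Suc i)
    then show ?case using assms(9)[of i] by simp
  qed (use assms(8) in simp)
  have X: "X (T + 1) \<in> borel_measurable M"
    and start: "1 - p \<le> \<P>(\<omega> in M. norm (X 0 \<omega> - prox_center f lam (\<lambda>i. X i \<omega>) 0)
      \<le> prev_radius \<delta> \<mu> lam 0)"
    and mid: "\<And>j. j < T \<Longrightarrow> 1 - p \<le> \<P>(\<omega> in M.
        norm (X (j + 1) \<omega> - prox_center f lam (\<lambda>i. X i \<omega>) (j + 1)) \<le> prev_radius \<delta> \<mu> lam (j + 1)
        \<bar> ?E j \<omega>)"
    and fin: "1 - p \<le> \<P>(\<omega> in M. ?G \<omega> \<bar> ?E T \<omega>)"
    using assms(11) unfolding prox_boost_def by auto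
  \<comment> \<open>The exponent counts the points with indices 0 to j. Positivity of this bound
    justifies the next conditioning.\<close>
  have E: "(1 - p) ^ Suc j \<le> \<P>(\<omega> in M. ?E j \<omega>)" if "j \<le> T" for j
    using that
  proof (induction j)
    case 0
    show ?case using start by (simp add: prox_event_def dist_norm norm_minus_commute)
  next
    case (Suc j)
    have "(1 - p) * (1 - p) ^ Suc j \<le> \<P>(\<omega> in M.
        norm (X (j + 1) \<omega> - prox_center f lam (\<lambda>i. X i \<omega>) (j + 1)) \<le> prev_radius \<delta> \<mu> lam (j + 1)
        \<and> ?E j \<omega>)"
      using Suc assms(7) by (intro prob_conj_ge_if_cond_prob_ge mid) auto
    moreover have "?E (Suc j) \<omega> \<longleftrightarrow>
        norm (X (j + 1) \<omega> - prox_center f lam (\<lambda>i. X i \<omega>) (j + 1)) \<le> prev_radius \<delta> \<mu> lam (j + 1)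
        \<and> ?E j \<omega>" for \<omega>
      by (auto simp: prox_event_def dist_norm norm_minus_commute le_Suc_eq)
    ultimately show ?case by simp
  qed
  have GE: "(1 - p) * (1 - p) ^ Suc T \<le> \<P>(\<omega> in M. ?G \<omega> \<and> ?E T \<omega>)"
    using assms(7) by (intro prob_conj_ge_if_cond_prob_ge fin E) auto
  \<comment> \<open>The deterministic part: \<open>f (X (T + 1) \<omega>)\<close> is at most the
    value of \<open>f^T\<close> there, hence at most
    \<open>min f^T + \<delta> \<le> m + \<delta> * S + \<delta>\<close>.\<close>
  have A: "?A \<omega>" if "?G \<omega>" "?E T \<omega>" for \<omega>
  proof -
    let ?g = "prox_obj f (lam T) (X T \<omega>)"
    have "min_value ?g \<le> ereal (m + \<delta> * S)"
      using min_value_prox_obj_bound[OF f _ lam m that(2)] assms(5) by (simp add: S_def)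
    \<comment> \<open>With a finite minimum, the extended-real difference in \<open>?G\<close> can
      be rearranged.\<close>
    moreover have "min_value ?g \<noteq> -\<infinity>"
      using assms(1) by (simp add: min_value_def prox_obj_def proper_fun_def)
    ultimately obtain b where b: "min_value ?g = ereal b" "b \<le> m + \<delta> * S"
      by (cases "min_value ?g") auto
    have "?g (X (T + 1) \<omega>) \<le> ereal (b + \<delta>)"
      using that(1) b(1) by (cases "?g (X (T + 1) \<omega>)") auto
    then have "f (X (T + 1) \<omega>) \<le> ereal (b + \<delta>)"
      by (rule order_trans[OF le_prox_obj[OF lam[OF order_refl]]])
    then show ?thesis
      using b(2) m by (cases "f (X (T + 1) \<omega>)") (auto simp: algebra_simps)
  qed
  \<comment> \<open>Monotonicity of the measure requires the larger event to be measurable; it is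
    the preimage of a closed sublevel set of f under a measurable map.\<close>
  have "?A \<omega> \<longleftrightarrow> X (T + 1) \<omega> \<in> {x. f x \<le> ereal (m + \<delta> * (1 + S))}" for \<omega>
    using m by (cases "f (X (T + 1) \<omega>)") (auto simp: algebra_simps)
  moreover have "{x. f x \<le> ereal (m + \<delta> * (1 + S))} \<in> sets borel"
    using closed_fun_sublevel[OF assms(2)] by (rule borel_closed)
  ultimately have "{\<omega> \<in> space M. ?A \<omega>} \<in> events"
    using measurable_sets[OF X, of "{x. f x \<le> ereal (m + \<delta> * (1 + S))}"]
    by (simp add: vimage_def Int_def conj_commute)
  then have "\<P>(\<omega> in M. ?G \<omega> \<and> ?E T \<omega>) \<le> \<P>(\<omega> in M. ?A \<omega>)"
    using A by (intro finite_measure_mono) auto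
  moreover have "1 - (real T + 2) * p \<le> (1 - p) ^ (T + 2)"
    using Bernoulli_inequality[of "- p" "T + 2"] assms(7) by (simp add: algebra_simps)
  ultimately show ?thesis using GE by (simp add: S_def)
qed

end
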